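(* Let $C$ be a command. If $x\neq\emptyset$ is a finite configuration of $[\![C]\!]$ with a covering chain $\emptyset \subset x_1 \subset \dots \subset x_n = x$ whose sequence of added events (read through their labels) is the word $\omega$, then there exists $C'$ such that $C \overset{\omega}{\twoheadrightarrow} C'$.
   Context: Commands over a set of atomic actions $Act$: $C ::= \mathtt{skip} \mid a \in Act \mid C;C \mid C + C \mid C \parallel C$. Labels are $L = Act\cup\{sk\}$, and $\checkmark$ denotes a terminated computation. Small-step rules: $\mathtt{skip}\xrightarrow{sk}\checkmark$, $a\xrightarrow{a}\checkmark$; if $C_1\xrightarrow{l}\checkmark$ then $C_1;C_2\xrightarrow{l}C_2$, and if $C_1\xrightarrow{l}C_1'$ then $C_1;C_2\xrightarrow{l}C_1';C_2$; $C_1+C_2$ makes any move of $C_1$ or of $C_2$ (to $\checkmark$ or the residual of that component, discarding the other); $C_1\parallel C_2$ interleaves: a move of $C_i$ to $C_i'$ gives the parallel composition with $C_i$ replaced by $C_i'$, and a move of $C_i$ to $\checkmark$ leaves the other component. A word is a finite non-empty sequence of labels; $C\overset{l}{\twoheadrightarrow}C'$ if $C\xrightarrow{l}C'$, and $C\overset{l:\omega'}{\twoheadrightarrow}C'$ if $C\xrightarrow{l}C''$ and $C''\overset{\omega'}{\twoheadrightarrow}C'$. An event structure $(E,\le,\#)$ has a partial order $\le$ with finite down-closures and an irreflexive symmetric conflict relation $\#$ with $e\#e'\le e''\Rightarrow e\#e''$. A configuration is a conflict-free, down-closed subset of $E$; a covering chain of $x$ is a sequence $\emptyset\subset x_1\subset\cdots\subset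 x_n=x$ of finite configurations each adding exactly one event. The interpretation $[\![C]\!]$: $[\![\mathtt{skip}]\!]$ and $[\![a]\!]$ are one-event structures with event $sk$, resp. $a$; $[\![C_1;C_2]\!]$ has events $E_1\uplus(E_2\times \mathcal{C}^{max}([\![C_1]\!]))$ (copies $(e_2,x)$ of $E_2$-events for each maximal configuration $x$ of $[\![C_1]\!]$), order from both components plus $e_1\le(e_2,x)$ whenever $e_1\in x$, conflict inherited from $E_1$ downward and within each copy of $E_2$; $[\![C_1+C_2]\!]$ is the disjoint union with every event of $[\![C_1]\!]$ in conflict with every event of $[\![C_2]\!]$; $[\![C_1\parallel C_2]\!]$ is the disjoint union with no extra order or conflict. Events (and their copies) carry the label of the action they come from. *)

theory Defs
  imports "HOL-Library.FSet"
begin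

section \<open>Commands and their operational semantics\<close>

datatype 'a com =
    Skip
  | Atom 'a
  | Seq "'a com" "'a com"
  | Choice "'a com" "'a com"
  | Par "'a com" "'a com"

datatype 'a label = Act 'a | Sk

text \<open>The target of a transition is a command or the terminated computation;
  the latter is not a command.\<close>

datatype 'a state = Tick | Run "'a com"

inductive step :: "'a com \<Rightarrow> 'a label \<Rightarrow> 'a state \<Rightarrow> bool"
  ("_ \<midarrow>_\<rightarrow> _" [60, 0, 60] 55) where
  step_skip:     "Skip \<midarrow>Sk\<rightarrow> Tick"
| step_atom:     "Atom a \<midarrow>Act a\<rightarrow> Tick"
| step_seq_tick: "C1 \<midarrow>l\<rightarrow> Tick \<Longrightarrow> Seq C1 C2 \<midarrow>l\<rightarrow> Run C2"
| step_seq_run:  "C1 \<midarrow>l\<rightarrow> Run C1' \<Longrightarrow> Seq C1 C2 \<midarrow>l\<rightarrow> Run (Seq C1' C2)"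
| step_choice_l: "C1 \<midarrow>l\<rightarrow> s \<Longrightarrow> Choice C1 C2 \<midarrow>l\<rightarrow> s"
| step_choice_r: "C2 \<midarrow>l\<rightarrow> s \<Longrightarrow> Choice C1 C2 \<midarrow>l\<rightarrow> s"
| step_par_l_tick: "C1 \<midarrow>l\<rightarrow> Tick \<Longrightarrow> Par C1 C2 \<midarrow>l\<rightarrow> Run C2"
| step_par_l_run:  "C1 \<midarrow>l\<rightarrow> Run C1' \<Longrightarrow> Par C1 C2 \<midarrow>l\<rightarrow> Run (Par C1' C2)"
| step_par_r_tick: "C2 \<midarrow>l\<rightarrow> Tick \<Longrightarrow> Par C1 C2 \<midarrow>l\<rightarrow> Run C1"
| step_par_r_run:  "C2 \<midarrow>l\<rightarrow> Run C2' \<Longrightarrow> Par C1 C2 \<midarrow>l\<rightarrow> Run (Par C1 C2')"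

text \<open>Words are non-empty: no rule concerns the empty list.\<close>

inductive word_step :: "'a com \<Rightarrow> 'a label list \<Rightarrow> 'a state \<Rightarrow> bool"
  ("_ \<midarrow>_\<twoheadrightarrow> _" [60, 0, 60] 55) where
  word_step_single: "C \<midarrow>l\<rightarrow> s \<Longrightarrow> C \<midarrow>[l]\<twoheadrightarrow> s"
| word_step_cons:   "C \<midarrow>l\<rightarrow> Run C'' \<Longrightarrow> C'' \<midarrow>w\<twoheadrightarrow> s \<Longrightarrow> C \<midarrow>l # w\<twoheadrightarrow> s"


section \<open>Event structures\<close>

record 'e es =
  events   :: "'e set"
  order    :: "'e rel"
  conflict :: "'e rel"

definition event_structure :: "'e es \<Rightarrow> bool" where
  "event_structure S \<longleftrightarrow>
     partial_order_on (events S) (order S) \<and>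
     (\<forall>e\<in>events S. finite {d. (d, e) \<in> order S}) \<and>
     conflict S \<subseteq> events S \<times> events S \<and>
     irrefl (conflict S) \<and> sym (conflict S) \<and>
     (\<forall>e e' e''. (e, e') \<in> conflict S \<longrightarrow> (e', e'') \<in> order S \<longrightarrow> (e, e'') \<in> conflict S)"

definition configuration :: "'e es \<Rightarrow> 'e set \<Rightarrow> bool" where
  "configuration S x \<longleftrightarrow>
     x \<subseteq> events S \<and>
     (\<forall>e\<in>x. \<forall>e'\<in>x. (e, e') \<notin> conflict S) \<and>
     (\<forall>e\<in>x. \<forall>d. (d, e) \<in> order S \<longrightarrow> d \<in> x)"

definition max_configuration :: "'e es \<Rightarrow> 'e set \<Rightarrow> bool" where
  "max_configuration S x \<longleftrightarrow>
     configuration S x \<and> (\<forall>y. configuration S y \<longrightarrow> x \<subseteq> y \<longrightarrow> y = x)"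

text \<open>\<open>xs = [{}, x\<^sub>1, \<dots>, x\<^sub>n]\<close> is a covering chain of \<open>x\<close>, and
  \<open>es = [e\<^sub>1, \<dots>, e\<^sub>n]\<close> lists the events it adds.\<close>

definition covering_chain :: "'e es \<Rightarrow> 'e set \<Rightarrow> 'e set list \<Rightarrow> 'e list \<Rightarrow> bool" where
  "covering_chain S x xs es \<longleftrightarrow>
     length xs = Suc (length es) \<and> hd xs = {} \<and> last xs = x \<and>
     (\<forall>y\<in>set xs. configuration S y \<and> finite y) \<and>
     (\<forall>i<length es. es ! i \<notin> xs ! i \<and> xs ! Suc i = insert (es ! i) (xs ! i))"


section \<open>Interpretation of commands\<close>

text \<open>One type holds the events of all commands: \<open>InL\<close> and \<open>InR\<close> tag disjoint unions and
  \<open>Copy e X\<close> is the copy \<open>(e, X)\<close> of \<open>e\<close>. Indexing copies by finite sets loses no maximal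
  configuration, since interpretations have finitely many events (\<open>finite_interp\<close> below).\<close>

datatype 'a event =
    Base "'a label"
  | InL "'a event"
  | InR "'a event"
  | Copy "'a event" "'a event fset"

primrec event_label :: "'a event \<Rightarrow> 'a label" where
  "event_label (Base l) = l"
| "event_label (InL e) = event_label e"
| "event_label (InR e) = event_label e"
| "event_label (Copy e X) = event_label e"

definition es_single :: "'a label \<Rightarrow> 'a event es" where
  "es_single l = \<lparr>events = {Base l}, order = {(Base l, Base l)}, conflict = {}\<rparr>"

definition seq_order :: "'a event es \<Rightarrow> 'a event es \<Rightarrow> 'a event rel" where
  "seq_order S T =
     {(InL d, InL e) | d e. (d, e) \<in> order S} \<union>
     {(Copy d X, Copy e X) | d e X. (d, e) \<in> order T \<and> max_configuration S (fset X)} \<union>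
     {(InL d, Copy e X) | d e X. d |\<in>| X \<and> e \<in> events T \<and> max_configuration S (fset X)}"

text \<open>Copies over different maximal configurations \<open>X\<close>, \<open>Y\<close> conflict by inheritance:
  \<open>X \<union> Y\<close> contains a conflict of \<open>S\<close> by maximality.\<close>

definition seq_conflict :: "'a event es \<Rightarrow> 'a event es \<Rightarrow> 'a event rel" where
  "seq_conflict S T =
     {(u, v) | u v. \<exists>d d'. (d, d') \<in> conflict S \<and>
        (InL d, u) \<in> seq_order S T \<and> (InL d', v) \<in> seq_order S T} \<union>
     {(Copy e X, Copy e' X) | e e' X. (e, e') \<in> conflict T \<and> max_configuration S (fset X)}"

definition es_seq :: "'a event es \<Rightarrow> 'a event es \<Rightarrow> 'a event es" where
  "es_seq S T =
     \<lparr>events = InL ` events S \<union> {Copy e X | e X. e \<in> events T \<and> max_configuration S (fset X)},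
      order = seq_order S T,
      conflict = seq_conflict S T\<rparr>"

definition sum_order :: "'a event es \<Rightarrow> 'a event es \<Rightarrow> 'a event rel" where
  "sum_order S T =
     {(InL d, InL e) | d e. (d, e) \<in> order S} \<union> {(InR d, InR e) | d e. (d, e) \<in> order T}"

definition sum_conflict :: "'a event es \<Rightarrow> 'a event es \<Rightarrow> 'a event rel" where
  "sum_conflict S T =
     {(InL d, InL e) | d e. (d, e) \<in> conflict S} \<union>
     {(InR d, InR e) | d e. (d, e) \<in> conflict T}"

definition es_choice :: "'a event es \<Rightarrow> 'a event es \<Rightarrow> 'a event es" where
  "es_choice S T =
     \<lparr>events = InL ` events S \<union> InR ` events T,
      order = sum_order S T,
      conflict = sum_conflict S T \<union>
        (InL ` events S) \<times> (InR ` events T) \<union> (InR ` events T) \<times> (InL ` events S)\<rparr>"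

definition es_par :: "'a event es \<Rightarrow> 'a event es \<Rightarrow> 'a event es" where
  "es_par S T =
     \<lparr>events = InL ` events S \<union> InR ` events T,
      order = sum_order S T,
      conflict = sum_conflict S T\<rparr>"

primrec interp :: "'a com \<Rightarrow> 'a event es" ("\<lbrakk>_\<rbrakk>") where
  "\<lbrakk>Skip\<rbrakk> = es_single Sk"
| "\<lbrakk>Atom a\<rbrakk> = es_single (Act a)"
| "\<lbrakk>Seq C1 C2\<rbrakk> = es_seq \<lbrakk>C1\<rbrakk> \<lbrakk>C2\<rbrakk>"
| "\<lbrakk>Choice C1 C2\<rbrakk> = es_choice \<lbrakk>C1\<rbrakk> \<lbrakk>C2\<rbrakk>"
| "\<lbrakk>Par C1 C2\<rbrakk> = es_par \<lbrakk>C1\<rbrakk> \<lbrakk>C2\<rbrakk>"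

lemma finite_interp: "finite (events \<lbrakk>C\<rbrakk>)"
proof (induction C)
  case (Seq C1 C2)
  have "{X. max_configuration \<lbrakk>C1\<rbrakk> (fset X)} \<subseteq> fset -` Pow (events \<lbrakk>C1\<rbrakk>)"
    by (auto simp: max_configuration_def configuration_def)
  moreover have "finite (fset -` Pow (events \<lbrakk>C1\<rbrakk>))"
    using Seq by (intro finite_vimageI) (auto simp: inj_def fset_inject)
  ultimately have "finite {X. max_configuration \<lbrakk>C1\<rbrakk> (fset X)}"
    by (rule finite_subset)
  then have "finite ((\<lambda>(e, X). Copy e X) ` (events \<lbrakk>C2\<rbrakk> \<times> {X. max_configuration \<lbrakk>C1\<rbrakk> (fset X)}))"
    using Seq by blast
  then have "finite {Copy e X | e X. e \<in> events \<lbrakk>C2\<rbrakk> \<and> max_configuration \<lbrakk>C1\<rbrakk> (fset X)}"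
    by (rule rev_finite_subset) auto
  then show ?case using Seq by (simp add: es_seq_def)
qed (simp_all add: es_single_def es_choice_def es_par_def)

lemma event_structure_finiteI:
  assumes "finite (events S)" "order S \<subseteq> events S \<times> events S"
    and "\<And>e. e \<in> events S \<Longrightarrow> (e, e) \<in> order S"
    and "\<And>e e' e''. (e, e') \<in> order S \<Longrightarrow> (e', e'') \<in> order S \<Longrightarrow> (e, e'') \<in> order S"
    and "\<And>e e'. (e, e') \<in> order S \<Longrightarrow> (e', e) \<in> order S \<Longrightarrow> e = e'"
    and "conflict S \<subseteq> events S \<times> events S"
    and "\<And>e. (e, e) \<notin> conflict S"
    and "\<And>e e'. (e, e') \<in> conflict S \<Longrightarrow> (e', e) \<in> conflict S"
    and "\<And>e e' e''. (e, e') \<in> conflict S \<Longrightarrow> (e', e'') \<in> order S \<Longrightarrow> (e, e'') \<in> conflict S"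
  shows "event_structure S"
proof -
  have "finite {d. (d, e) \<in> order S}" for e
    using assms(1,2) by (elim finite_subset[rotated]) auto
  moreover have "partial_order_on (events S) (order S)"
    unfolding partial_order_on_def preorder_on_def
    using assms(2,3) by (auto simp: refl_on_def antisym_def intro!: transI dest: assms(4,5))
  ultimately show ?thesis
    unfolding event_structure_def irrefl_def sym_def using assms(6-9) by blast
qed

lemma event_structureD:
  assumes "event_structure S"
  shows "order S \<subseteq> events S \<times> events S"
    and "e \<in> events S \<Longrightarrow> (e, e) \<in> order S"
    and "(e, e') \<in> order S \<Longrightarrow> (e', e'') \<in> order S \<Longrightarrow> (e, e'') \<in> order S"
    and "(e, e') \<in> order S \<Longrightarrow> (e', e) \<in> order S \<Longrightarrow> e = e'"
    and "conflict S \<subseteq> events S \<times> events S"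
    and "(e, e) \<notin> conflict S"
    and "(e, e') \<in> conflict S \<Longrightarrow> (e', e) \<in> conflict S"
    and "(e, e') \<in> conflict S \<Longrightarrow> (e', e'') \<in> order S \<Longrightarrow> (e, e'') \<in> conflict S"
  using assms
  unfolding event_structure_def partial_order_on_def preorder_on_def refl_on_def antisym_def
      irrefl_def sym_def trans_def by blast+

lemma event_structure_interp: "event_structure \<lbrakk>C\<rbrakk>"
proof (induction C)
  case (Seq C1 C2)
  note D1 = event_structureD[OF Seq.IH(1)] and D2 = event_structureD[OF Seq.IH(2)]
  let ?S = "\<lbrakk>C1\<rbrakk>" and ?T = "\<lbrakk>C2\<rbrakk>"
  have max: "configuration ?S (fset X)" if "max_configuration ?S (fset X)" for X
    using that by (simp add: max_configuration_def)
  have sub: "e \<in> events ?S" if "max_configuration ?S (fset X)" "e |\<in>| X" for e X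
    using max[OF that(1)] that(2) by (auto simp: configuration_def)
  have down: "d |\<in>| X" if "max_configuration ?S (fset X)" "e |\<in>| X" "(d, e) \<in> order ?S" for d e X
    using max[OF that(1)] that(2,3) by (auto simp: configuration_def)
  have free: "(d, e) \<notin> conflict ?S"
    if "max_configuration ?S (fset X)" "e |\<in>| X" "d |\<in>| X" for d e X
    using max[OF that(1)] that(2,3) by (auto simp: configuration_def)
  have trans: "(e, e'') \<in> seq_order ?S ?T"
    if "(e, e') \<in> seq_order ?S ?T" "(e', e'') \<in> seq_order ?S ?T" for e e' e''
    using that unfolding seq_order_def
    by (cases e; cases e'; cases e''; simp; blast intro: D1(3) D2(3) down dest: subsetD[OF D2(1)])
  have irr: "(e, e) \<notin> seq_conflict ?S ?T" for e
  proof
    assume "(e, e) \<in> seq_conflict ?S ?T"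
    then consider
      (a) d d' where "(d, d') \<in> conflict ?S" "(InL d, e) \<in> seq_order ?S ?T"
        "(InL d', e) \<in> seq_order ?S ?T"
      | (b) u where "(u, u) \<in> conflict ?T"
      unfolding seq_conflict_def by blast
    then show False
    proof cases
      case a
      show False
      proof (cases e)
        case (InL c)
        then have "(d, c) \<in> order ?S" "(d', c) \<in> order ?S"
          using a by (simp_all add: seq_order_def)
        then show False using a(1) D1(6,7,8) by metis
      next
        case (Copy c X)
        then show False using a free by (auto simp: seq_order_def)
      qed (use a in \<open>simp_all add: seq_order_def\<close>)
    next
      case b
      then show False using D2(6) by blast
    qed
  qed
  have her: "(e, e'') \<in> seq_conflict ?S ?T"
    if ec: "(e, e') \<in> seq_conflict ?S ?T" and eo: "(e', e'') \<in> seq_order ?S ?T" for e e' e''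
  proof -
    from ec consider
      (a) d d' where "(d, d') \<in> conflict ?S" "(InL d, e) \<in> seq_order ?S ?T"
        "(InL d', e') \<in> seq_order ?S ?T"
      | (b) u v X where "e = Copy u X" "e' = Copy v X" "(u, v) \<in> conflict ?T"
        "max_configuration ?S (fset X)"
      unfolding seq_conflict_def by blast
    then show ?thesis
    proof cases
      case a
      then show ?thesis using trans[OF a(3) eo] unfolding seq_conflict_def by blast
    next
      case b
      obtain w where w: "e'' = Copy w X" "(v, w) \<in> order ?T"
        using eo unfolding b(2) seq_order_def by blast
      have "(u, w) \<in> conflict ?T"
        using b(3) w(2) by (rule D2(8))
      then show ?thesis using b(1,4) w(1) unfolding seq_conflict_def by blast
    qed
  qed
  show ?case
  proof (rule event_structure_finiteI)
    show "finite (events \<lbrakk>Seq C1 C2\<rbrakk>)" by (rule finite_interp)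
    show ord: "order \<lbrakk>Seq C1 C2\<rbrakk> \<subseteq> events \<lbrakk>Seq C1 C2\<rbrakk> \<times> events \<lbrakk>Seq C1 C2\<rbrakk>"
      by (auto simp: es_seq_def seq_order_def dest: subsetD[OF D1(1)] subsetD[OF D2(1)] sub)
    show "conflict \<lbrakk>Seq C1 C2\<rbrakk> \<subseteq> events \<lbrakk>Seq C1 C2\<rbrakk> \<times> events \<lbrakk>Seq C1 C2\<rbrakk>"
    proof -
      have "seq_conflict ?S ?T \<subseteq> events \<lbrakk>Seq C1 C2\<rbrakk> \<times> events \<lbrakk>Seq C1 C2\<rbrakk>"
        using ord unfolding seq_conflict_def
        by (auto simp: es_seq_def dest: subsetD[OF D2(5)])
      then show ?thesis by (simp add: es_seq_def)
    qed
    show "(e, e) \<in> order \<lbrakk>Seq C1 C2\<rbrakk>" if "e \<in> events \<lbrakk>Seq C1 C2\<rbrakk>" for e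
      using that D1(2) D2(2) by (auto simp: es_seq_def seq_order_def)
    show "e = e'" if "(e, e') \<in> order \<lbrakk>Seq C1 C2\<rbrakk>" "(e', e) \<in> order \<lbrakk>Seq C1 C2\<rbrakk>" for e e'
      using that by (auto simp: es_seq_def seq_order_def dest: D1(4) D2(4))
    show "(e', e) \<in> conflict \<lbrakk>Seq C1 C2\<rbrakk>" if "(e, e') \<in> conflict \<lbrakk>Seq C1 C2\<rbrakk>" for e e'
      using that unfolding interp.simps es_seq_def seq_conflict_def es.simps
      by (blast intro: D1(7) D2(7))
    show "(e, e) \<notin> conflict \<lbrakk>Seq C1 C2\<rbrakk>" for e
      using irr by (simp add: es_seq_def)
    show "(e, e'') \<in> order \<lbrakk>Seq C1 C2\<rbrakk>"
      if "(e, e') \<in> order \<lbrakk>Seq C1 C2\<rbrakk>" "(e', e'') \<in> order \<lbrakk>Seq C1 C2\<rbrakk>" for e e' e''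
      using trans[of e e' e''] that by (simp add: es_seq_def)
    show "(e, e'') \<in> conflict \<lbrakk>Seq C1 C2\<rbrakk>"
      if "(e, e') \<in> conflict \<lbrakk>Seq C1 C2\<rbrakk>" "(e', e'') \<in> order \<lbrakk>Seq C1 C2\<rbrakk>" for e e' e''
      using her[of e e' e''] that by (simp add: es_seq_def)
  qed
next
  case (Choice C1 C2)
  note D1 = event_structureD[OF Choice.IH(1)] and D2 = event_structureD[OF Choice.IH(2)]
  show ?case
    by (rule event_structure_finiteI)
      (use finite_interp[of "Choice C1 C2"] in
        \<open>auto simp: es_choice_def sum_order_def sum_conflict_def
           dest: subsetD[OF D1(1)] subsetD[OF D2(1)] D1(4) D2(4)
             subsetD[OF D1(5)] subsetD[OF D2(5)]
           intro: D1(3,7,8) D2(3,7,8)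
           simp: D1(2,6) D2(2,6)\<close>)
next
  case (Par C1 C2)
  note D1 = event_structureD[OF Par.IH(1)] and D2 = event_structureD[OF Par.IH(2)]
  show ?case
    by (rule event_structure_finiteI)
      (use finite_interp[of "Par C1 C2"] in
        \<open>auto simp: es_par_def sum_order_def sum_conflict_def
           dest: subsetD[OF D1(1)] subsetD[OF D2(1)] D1(4) D2(4)
             subsetD[OF D1(5)] subsetD[OF D2(5)]
           intro: D1(3,7,8) D2(3,7,8)
           simp: D1(2,6) D2(2,6)\<close>)
qed (rule event_structure_finiteI; simp add: es_single_def)+

end

(* Strengthen the claim for structural induction: the events of a covering chain can be run from
   the command, and the run ends in Tick whenever the chain reaches a maximal configuration. The
   second part is what lets a sequential composition continue with its second component, since a
   copied event of the second component occurs only above a maximal configuration of the first.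
   It also excludes that the empty configuration is maximal, as an empty run does not reach Tick. *)

theory Submission
  imports Defs
begin

section \<open>Runs from states, over possibly empty words\<close>

text \<open>Unlike \<open>word_step\<close>, this starts from a state and admits the empty word, so
  runs can be concatenated even where the first one ends in \<open>Tick\<close>.\<close>

fun run :: "'a state \<Rightarrow> 'a label list \<Rightarrow> 'a state \<Rightarrow> bool" where
  "run s [] t \<longleftrightarrow> s = t"
| "run Tick (l # w) t \<longleftrightarrow> False"
| "run (Run C) (l # w) t \<longleftrightarrow> (\<exists>s. C \<midarrow>l\<rightarrow> s \<and> run s w t)"

lemma run_append: "run s v t \<Longrightarrow> run t w u \<Longrightarrow> run s (v @ w) u"
  by (induction s v t rule: run.induct) auto

lemma run_imp_word_step: "run (Run C) w s \<Longrightarrow> w \<noteq> [] \<Longrightarrow> C \<midarrow>w\<twoheadrightarrow> s"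
proof (induction w arbitrary: C)
  case (Cons l w)
  then obtain s' where s': "C \<midarrow>l\<rightarrow> s'" "run s' w s" by auto
  show ?case
  proof (cases w)
    case Nil
    then show ?thesis using s' by (auto intro: word_step_single)
  next
    case (Cons k v)
    \<comment> \<open>\<open>Tick\<close> has no run over a non-empty word, so the intermediate
      state is a command, as \<open>word_step_cons\<close> requires.\<close>
    then obtain C' where "s' = Run C'" using s'(2) by (cases s') auto
    then show ?thesis using s' Cons.IH Cons by (auto intro: word_step_cons)
  qed
qed simp

text \<open>Sequential composition lifted to states: termination of the first component hands
  control to the second. This merges the two rules for \<open>Seq\<close> into one.\<close>

fun seq_state :: "'a com \<Rightarrow> 'a state \<Rightarrow> 'a state" where
  "seq_state C2 Tick = Run C2"
| "seq_state C2 (Run C1) = Run (Seq C1 C2)"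

lemma run_seq: "run s w t \<Longrightarrow> run (seq_state C s) w (seq_state C t)"
proof (induction s w t rule: run.induct)
  case (3 C1 l w t)
  then obtain s where s: "C1 \<midarrow>l\<rightarrow> s" "run s w t" by auto
  then have "Seq C1 C \<midarrow>l\<rightarrow> seq_state C s"
    by (cases s) (auto intro: step_seq_tick step_seq_run)
  then show ?case using 3 s by auto
qed auto

text \<open>Parallel composition lifted to states, with \<open>Tick\<close> as neutral element, so
  that a move needs no case distinction on whether either component has terminated.\<close>

fun par_state :: "'a state \<Rightarrow> 'a state \<Rightarrow> 'a state" where
  "par_state Tick s = s"
| "par_state s Tick = s"
| "par_state (Run C1) (Run C2) = Run (Par C1 C2)"

lemma par_state_Tick [simp]: "par_state s Tick = s"
  by (cases s) auto

text \<open>A run over a one-letter word replaces \<open>step\<close> here because the source is a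
  state, whose shape depends on \<open>t\<close>.\<close>

lemma run_par_left: "C \<midarrow>l\<rightarrow> s \<Longrightarrow> run (par_state (Run C) t) [l] (par_state s t)"
  by (cases s; cases t) (auto intro: step.intros)

lemma run_par_right: "C \<midarrow>l\<rightarrow> s \<Longrightarrow> run (par_state t (Run C)) [l] (par_state t s)"
  by (cases s; cases t) (auto intro: step.intros)

section \<open>Projecting lists of events to the components\<close>

fun left_event :: "'a event \<Rightarrow> 'a event option" where
  "left_event (InL e) = Some e"
| "left_event _ = None"

fun right_event :: "'a event \<Rightarrow> 'a event option" where
  "right_event (InR e) = Some e"
| "right_event _ = None"

text \<open>Fixing the index \<open>X\<close> makes this projection injective where it is defined,
  as \<open>securing_map_filter\<close> demands.\<close>

fun copied_event :: "'a event fset \<Rightarrow> 'a event \<Rightarrow> 'a event option" where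
  "copied_event X (Copy e Y) = (if Y = X then Some e else None)"
| "copied_event X _ = None"

lemma left_event_eq_Some [simp]: "left_event e = Some d \<longleftrightarrow> e = InL d"
  by (cases e) auto

lemma right_event_eq_Some [simp]: "right_event e = Some d \<longleftrightarrow> e = InR d"
  by (cases e) auto

lemma copied_event_eq_Some [simp]: "copied_event X e = Some d \<longleftrightarrow> e = Copy d X"
  by (cases e) auto

lemma set_map_filter_eq: "set (List.map_filter g es) = {d. \<exists>e\<in>set es. g e = Some d}"
  by (induction es) (auto split: option.splits)

lemma map_filter_append:
  "List.map_filter g (es @ ds) = List.map_filter g es @ List.map_filter g ds"
  by (induction es) (auto split: option.splits)

lemma map_filter_map_Some:
  "(\<And>d. g (f d) = Some d) \<Longrightarrow> List.map_filter g (map f ds) = ds"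
  by (induction ds) auto

lemma map_filter_map_None:
  "(\<And>d. g (f d) = None) \<Longrightarrow> List.map_filter g (map f ds) = []"
  by (induction ds) auto

text \<open>The list is an interleaving of its two projections, and the tag of its head tells which
  component makes the next move while the other state stays put.\<close>

lemma run_par:
  assumes "set es \<subseteq> range InL \<union> range InR"
    and "run s (map event_label (List.map_filter left_event es)) s'"
    and "run t (map event_label (List.map_filter right_event es)) t'"
  shows "run (par_state s t) (map event_label es) (par_state s' t')"
  using assms
proof (induction es arbitrary: s t)
  case (Cons e es)
  consider d where "e = InL d" | d where "e = InR d" using Cons.prems(1) by auto
  then show ?case
  proof cases
    case 1
    with Cons.prems(2) obtain C r where r: "s = Run C" "C \<midarrow>event_label d\<rightarrow> r"
        "run r (map event_label (List.map_filter left_event es)) s'"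
      by (cases s) auto
    have "run (par_state r t) (map event_label es) (par_state s' t')"
      using Cons r 1 by auto
    then show ?thesis using run_append[OF run_par_left[OF r(2)]] r(1) 1 by fastforce
  next
    case 2
    with Cons.prems(3) obtain C r where r: "t = Run C" "C \<midarrow>event_label d\<rightarrow> r"
        "run r (map event_label (List.map_filter right_event es)) t'"
      by (cases t) auto
    have "run (par_state s r) (map event_label es) (par_state s' t')"
      using Cons r 2 by auto
    then show ?thesis using run_append[OF run_par_right[OF r(2)]] r(1) 2 by fastforce
  qed
qed simp

section \<open>Covering chains as lists of added events\<close>

text \<open>A covering chain is determined by the events it adds: its members are the sets of the
  prefixes. Keeping only that list and growing it at the end gives an induction along the
  chain.\<close>

inductive securing :: "'e es \<Rightarrow> 'e list \<Rightarrow> bool" for S where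
  securing_Nil: "securing S []"
| securing_snoc: "securing S es \<Longrightarrow> e \<notin> set es \<Longrightarrow> configuration S (insert e (set es))
    \<Longrightarrow> securing S (es @ [e])"

lemma configuration_empty: "configuration S {}"
  by (simp add: configuration_def)

lemma securing_configuration: "securing S es \<Longrightarrow> configuration S (set es)"
  by (induction rule: securing.induct) (simp_all add: configuration_empty)

lemma securing_distinct: "securing S es \<Longrightarrow> distinct es"
  by (induction rule: securing.induct) auto

lemma covering_chain_imp_securing:
  assumes "covering_chain S x xs es"
  shows "securing S es"
proof -
  \<comment> \<open>The invariant identifies member \<open>n\<close> of the chain with the set of
    the first \<open>n\<close> events; \<open>xs\<close> is one longer than \<open>es\<close>, so
    index \<open>length es\<close> is still valid.\<close>
  have "securing S (take n es) \<and> set (take n es) = xs ! n" if "n \<le> length es" for n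
    using that
  proof (induction n)
    case 0
    have "xs ! 0 = {}"
      using assms by (cases xs) (auto simp: covering_chain_def)
    then show ?case by (simp add: securing_Nil)
  next
    case (Suc n)
    then have step: "xs ! Suc n = insert (es ! n) (xs ! n)" "es ! n \<notin> xs ! n"
      and mem: "xs ! Suc n \<in> set xs"
      using assms nth_mem[of "Suc n" xs] by (simp_all add: covering_chain_def)
    have "configuration S (xs ! Suc n)"
      using assms mem by (simp add: covering_chain_def)
    with step have "securing S (take n es @ [es ! n])"
      using Suc by (intro securing_snoc) auto
    then show ?case
      using Suc step(1) by (simp add: take_Suc_conv_app_nth)
  qed
  from this[of "length es"] show ?thesis by simp
qed

text \<open>Projecting every member of the chain, an added event either disappears or adds its
  image; the image is new because \<open>g\<close> is injective where defined.\<close>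

lemma securing_map_filter:
  assumes "securing S es"
    and conf: "\<And>x. configuration S x \<Longrightarrow> configuration T {d. \<exists>e\<in>x. g e = Some d}"
    and inj: "\<And>e e' d. g e = Some d \<Longrightarrow> g e' = Some d \<Longrightarrow> e = e'"
  shows "securing T (List.map_filter g es)"
  using assms(1)
proof (induction rule: securing.induct)
  case (securing_snoc es e)
  show ?case
  proof (cases "g e")
    case None
    then show ?thesis
      using securing_snoc.IH by (simp add: map_filter_append)
  next
    case (Some d)
    have "{c. \<exists>e'\<in>insert e (set es). g e' = Some c} = insert d (set (List.map_filter g es))"
      using Some by (auto simp: set_map_filter_eq)
    then have "configuration T (insert d (set (List.map_filter g es)))"
      using conf[OF securing_snoc.hyps(3)] by simp
    moreover have "d \<notin> set (List.map_filter g es)"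
      using inj[OF Some] securing_snoc.hyps(2) by (auto simp: set_map_filter_eq)
    ultimately show ?thesis
      using Some securing_snoc.IH
      by (simp add: map_filter_append securing.securing_snoc)
  qed
qed (simp add: securing_Nil)

section \<open>General facts on configurations\<close>

lemma max_configurationD: "max_configuration S x \<Longrightarrow> configuration S y \<Longrightarrow> x \<subseteq> y \<Longrightarrow> y = x"
  by (simp add: max_configuration_def)

lemma configurationI:
  assumes "x \<subseteq> events S"
    and "\<And>e e'. e \<in> x \<Longrightarrow> e' \<in> x \<Longrightarrow> (e, e') \<notin> conflict S"
    and "\<And>d e. e \<in> x \<Longrightarrow> (d, e) \<in> order S \<Longrightarrow> d \<in> x"
  shows "configuration S x"
  using assms by (simp add: configuration_def)

lemma configurationD:
  assumes "configuration S x"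
  shows "e \<in> x \<Longrightarrow> e \<in> events S"
    and "e \<in> x \<Longrightarrow> e' \<in> x \<Longrightarrow> (e, e') \<notin> conflict S"
    and "e \<in> x \<Longrightarrow> (d, e) \<in> order S \<Longrightarrow> d \<in> x"
  using assms by (auto simp: configuration_def)

text \<open>Down-closure and conflict-freeness pull back along a map that preserves order and
  conflict. Preservation is asked only near \<open>x\<close>, since for copies it rests on the
  maximality of their index, which is known only for copies that occur in \<open>x\<close>.\<close>

lemma configuration_vimage:
  assumes "configuration T x"
    and "\<And>d. f d \<in> x \<Longrightarrow> d \<in> events S"
    and "\<And>d e. f d \<in> x \<Longrightarrow> (d, e) \<in> conflict S \<Longrightarrow> (f d, f e) \<in> conflict T"
    and "\<And>d e. f e \<in> x \<Longrightarrow> (d, e) \<in> order S \<Longrightarrow> (f d, f e) \<in> order T"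
  shows "configuration S {d. f d \<in> x}"
proof (rule configurationI)
  fix d e assume "e \<in> {d. f d \<in> x}" "(d, e) \<in> order S"
  then show "d \<in> {d. f d \<in> x}"
    using configurationD(3)[OF assms(1)] assms(4) by blast
qed (use assms(2,3) configurationD(2)[OF assms(1)] in blast)+

subsection \<open>Single events\<close>

lemma securing_es_single:
  assumes "securing (es_single l) es"
  shows "es = [] \<or> es = [Base l]"
proof -
  have "set es \<subseteq> {Base l}"
    using securing_configuration[OF assms] by (simp add: configuration_def es_single_def)
  \<comment> \<open>\<open>remdups_adj.cases\<close> splits into no, one or at least two entries;
    distinctness excludes the last case.\<close>
  then show ?thesis
    using securing_distinct[OF assms] by (cases es rule: remdups_adj.cases) auto
qed

text \<open>Makes the claim about reaching \<open>Tick\<close> vacuous for the empty securing in the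
  base cases.\<close>

lemma not_max_configuration_es_single: "\<not> max_configuration (es_single l) {}"
proof
  assume "max_configuration (es_single l) {}"
  moreover have "configuration (es_single l) {Base l}"
    by (auto simp: configuration_def es_single_def)
  ultimately show False by (auto dest: max_configurationD)
qed

subsection \<open>Choice and parallel composition\<close>

lemma mem_InL_InR_image [simp]:
  "InL e \<in> InL ` x \<longleftrightarrow> e \<in> x" "InR e \<in> InR ` x \<longleftrightarrow> e \<in> x"
  "InL e \<notin> InR ` x" "InR e \<notin> InL ` x"
  by auto

lemma sum_order_simps [simp]:
  "(u, InL e) \<in> sum_order S T \<longleftrightarrow> (\<exists>d. u = InL d \<and> (d, e) \<in> order S)"
  "(u, InR e) \<in> sum_order S T \<longleftrightarrow> (\<exists>d. u = InR d \<and> (d, e) \<in> order T)"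
  by (auto simp: sum_order_def)

lemma sum_conflict_simps [simp]:
  "(u, InL e) \<in> sum_conflict S T \<longleftrightarrow> (\<exists>d. u = InL d \<and> (d, e) \<in> conflict S)"
  "(u, InR e) \<in> sum_conflict S T \<longleftrightarrow> (\<exists>d. u = InR d \<and> (d, e) \<in> conflict T)"
  by (auto simp: sum_conflict_def)

lemma configuration_par_left:
  assumes "configuration (es_par S T) x"
  shows "configuration S {d. InL d \<in> x}"
  by (rule configuration_vimage[OF assms])
    (use configurationD(1)[OF assms] in \<open>auto simp: es_par_def\<close>)

lemma configuration_par_right:
  assumes "configuration (es_par S T) x"
  shows "configuration T {d. InR d \<in> x}"
  by (rule configuration_vimage[OF assms])
    (use configurationD(1)[OF assms] in \<open>auto simp: es_par_def\<close>)

lemma configuration_parI: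
  assumes "configuration S x" "configuration T y"
  shows "configuration (es_par S T) (InL ` x \<union> InR ` y)"
  by (rule configurationI)
    (use configurationD[OF assms(1)] configurationD[OF assms(2)] in
      \<open>auto simp: es_par_def\<close>)

text \<open>Enlarging one projection while keeping the other yields a configuration above
  \<open>x\<close>, which maximality forces to be \<open>x\<close> itself.\<close>

lemma max_configuration_par:
  assumes "max_configuration (es_par S T) x"
  shows "max_configuration S {d. InL d \<in> x}" "max_configuration T {d. InR d \<in> x}"
proof -
  have c: "configuration (es_par S T) x"
    using assms by (simp add: max_configuration_def)
  note l = configuration_par_left[OF c] and r = configuration_par_right[OF c]
  have x: "x \<subseteq> range InL \<union> range InR"
    using c by (auto simp: configuration_def es_par_def)
  have "y = {d. InL d \<in> x}" if y: "configuration S y" "{d. InL d \<in> x} \<subseteq> y" for y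
  proof -
    have "x \<subseteq> InL ` y \<union> InR ` {d. InR d \<in> x}" using x y(2) by blast
    from max_configurationD[OF assms configuration_parI[OF y(1) r] this]
    show ?thesis by auto
  qed
  then show "max_configuration S {d. InL d \<in> x}"
    using l by (simp add: max_configuration_def)
  have "y = {d. InR d \<in> x}" if y: "configuration T y" "{d. InR d \<in> x} \<subseteq> y" for y
  proof -
    have "x \<subseteq> InL ` {d. InL d \<in> x} \<union> InR ` y" using x y(2) by blast
    from max_configurationD[OF assms configuration_parI[OF l y(1)] this]
    show ?thesis by auto
  qed
  then show "max_configuration T {d. InR d \<in> x}"
    using r by (simp add: max_configuration_def)
qed

lemma configuration_choice_left:
  assumes "configuration (es_choice S T) x"
  shows "configuration S {d. InL d \<in> x}"
  by (rule configuration_vimage[OF assms])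
    (use configurationD(1)[OF assms] in \<open>auto simp: es_choice_def\<close>)

lemma configuration_choice_right:
  assumes "configuration (es_choice S T) x"
  shows "configuration T {d. InR d \<in> x}"
  by (rule configuration_vimage[OF assms])
    (use configurationD(1)[OF assms] in \<open>auto simp: es_choice_def\<close>)

text \<open>Events of opposite sides conflict, so they cannot occur together. The empty
  configuration falls under both cases.\<close>

lemma configuration_choiceE:
  assumes "configuration (es_choice S T) x"
  obtains "x \<subseteq> range InL" | "x \<subseteq> range InR"
proof -
  note D = configurationD[OF assms]
  have x: "x \<subseteq> InL ` events S \<union> InR ` events T"
    using D(1) by (auto simp: es_choice_def)
  have "InR e \<notin> x" if "InL d \<in> x" for d e
    using D(1)[OF that] D(1)[of "InR e"] D(2)[OF that] by (auto simp: es_choice_def)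
  then show thesis using x that by blast
qed

lemma configuration_choice_InL:
  assumes "configuration S x"
  shows "configuration (es_choice S T) (InL ` x)"
  by (rule configurationI)
    (use configurationD[OF assms] in \<open>auto simp: es_choice_def\<close>)

lemma configuration_choice_InR:
  assumes "configuration T x"
  shows "configuration (es_choice S T) (InR ` x)"
  by (rule configurationI)
    (use configurationD[OF assms] in \<open>auto simp: es_choice_def\<close>)

text \<open>An extension of \<open>x\<close> in \<open>S\<close> is carried by \<open>InL\<close> to
  an extension in the choice.\<close>

lemma max_configuration_choice_InL:
  assumes "max_configuration (es_choice S T) (InL ` x)"
  shows "max_configuration S x"
  unfolding max_configuration_def
proof (intro conjI allI impI)
  show "configuration S x"
    using configuration_choice_left[of S T "InL ` x"] assms
    by (simp add: max_configuration_def image_iff)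
  fix y assume "configuration S y" "x \<subseteq> y"
  then have "InL ` y = InL ` x"
    by (intro max_configurationD[OF assms] configuration_choice_InL) auto
  then show "y = x" by auto
qed

lemma max_configuration_choice_InR:
  assumes "max_configuration (es_choice S T) (InR ` x)"
  shows "max_configuration T x"
  unfolding max_configuration_def
proof (intro conjI allI impI)
  show "configuration T x"
    using configuration_choice_right[of S T "InR ` x"] assms
    by (simp add: max_configuration_def image_iff)
  fix y assume "configuration T y" "x \<subseteq> y"
  then have "InR ` y = InR ` x"
    by (intro max_configurationD[OF assms] configuration_choice_InR) auto
  then show "y = x" by auto
qed

subsection \<open>Sequential composition\<close>

lemma seq_order_InL [simp]:
  "(u, InL e) \<in> seq_order S T \<longleftrightarrow> (\<exists>d. u = InL d \<and> (d, e) \<in> order S)"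
  by (auto simp: seq_order_def)

lemma seq_conflict_InL [simp]:
  "(InL d, InL e) \<in> seq_conflict S T \<longleftrightarrow>
    (\<exists>d' e'. (d', e') \<in> conflict S \<and> (d', d) \<in> order S \<and> (e', e) \<in> order S)"
  by (auto simp: seq_conflict_def)

lemma configuration_seq_left:
  assumes "event_structure S" "configuration (es_seq S T) x"
  shows "configuration S {d. InL d \<in> x}"
proof (rule configuration_vimage[OF assms(2)])
  fix d e assume "(d, e) \<in> conflict S"
  \<comment> \<open>Conflict in the composition is inherited from conflicting events below;
    reflexivity of the order lets the two events serve as their own witnesses.\<close>
  moreover from this have "(d, d) \<in> order S" "(e, e) \<in> order S"
    using event_structureD(2,5)[OF assms(1)] by blast+
  ultimately show "(InL d, InL e) \<in> conflict (es_seq S T)"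
    by (auto simp: es_seq_def)
qed (use configurationD(1)[OF assms(2)] in \<open>auto simp: es_seq_def\<close>)

lemma configuration_seq_max:
  assumes "configuration (es_seq S T) x" "Copy e X \<in> x"
  shows "max_configuration S (fset X)" "e \<in> events T"
  using assms by (auto simp: configuration_def es_seq_def)

lemma configuration_seq_right:
  assumes "configuration (es_seq S T) x"
  shows "configuration T {e. Copy e X \<in> x}"
  by (rule configuration_vimage[OF assms])
    (use configuration_seq_max[OF assms] in
      \<open>auto simp: es_seq_def seq_order_def seq_conflict_def\<close>)

text \<open>The copy lies above all of \<open>X\<close>, so down-closure puts \<open>X\<close> into
  the left part, and maximality of \<open>X\<close> leaves no room for more. Hence all copies in one
  configuration share their index.\<close>

lemma configuration_seq_Copy:
  assumes "event_structure S" "configuration (es_seq S T) x" "Copy e X \<in> x"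
  shows "{d. InL d \<in> x} = fset X"
proof (rule max_configurationD)
  show "max_configuration S (fset X)"
    using configuration_seq_max[OF assms(2,3)] by simp
  show "configuration S {d. InL d \<in> x}"
    using assms(1,2) by (rule configuration_seq_left)
  have "(InL d, Copy e X) \<in> order (es_seq S T)" if "d |\<in>| X" for d
    using that configuration_seq_max[OF assms(2,3)] by (auto simp: es_seq_def seq_order_def)
  then show "fset X \<subseteq> {d. InL d \<in> x}"
    using assms(2,3) by (auto simp: configuration_def)
qed

lemma configuration_seq_InL:
  assumes "configuration S x"
  shows "configuration (es_seq S T) (InL ` x)"
proof (rule configurationI)
  fix u v assume "u \<in> InL ` x" "v \<in> InL ` x"
  \<comment> \<open>An inherited conflict would have its sources in \<open>x\<close> by
    down-closure, where no conflict exists.\<close>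
  then show "(u, v) \<notin> conflict (es_seq S T)"
    using configurationD(2,3)[OF assms] by (auto simp: es_seq_def)
qed (use configurationD[OF assms] in \<open>auto simp: es_seq_def\<close>)

lemma configuration_seqI:
  assumes "max_configuration S (fset X)" "configuration T y"
  shows "configuration (es_seq S T) (InL ` fset X \<union> (\<lambda>e. Copy e X) ` y)"
proof -
  have X: "configuration S (fset X)" using assms(1) by (simp add: max_configuration_def)
  \<comment> \<open>Every left event under the new set lies in \<open>X\<close>, which is
    conflict-free; this rules out all inherited conflicts.\<close>
  have below: "d |\<in>| X"
    if "(InL d, u) \<in> seq_order S T" "u \<in> InL ` fset X \<union> (\<lambda>e. Copy e X) ` y" for d u
    using that X by (auto simp: seq_order_def configuration_def)
  show ?thesis
  proof (rule configurationI)
    show "InL ` fset X \<union> (\<lambda>e. Copy e X) ` y \<subseteq> events (es_seq S T)"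
      using assms(1) configurationD(1)[OF X] configurationD(1)[OF assms(2)]
      by (auto simp: es_seq_def)
  next
    fix u v
    assume u: "u \<in> InL ` fset X \<union> (\<lambda>e. Copy e X) ` y"
      and v: "v \<in> InL ` fset X \<union> (\<lambda>e. Copy e X) ` y"
    show "(u, v) \<notin> conflict (es_seq S T)"
    proof
      assume "(u, v) \<in> conflict (es_seq S T)"
      then consider
        (a) d d' where "(d, d') \<in> conflict S" "(InL d, u) \<in> seq_order S T"
          "(InL d', v) \<in> seq_order S T"
        | (b) e e' Y where "u = Copy e Y" "v = Copy e' Y" "(e, e') \<in> conflict T"
        by (auto simp: es_seq_def seq_conflict_def)
      then show False
      proof cases
        case a
        then show False using below[OF a(2) u] below[OF a(3) v] configurationD(2)[OF X] by blast
      next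
        case b
        then have "e \<in> y" "e' \<in> y" using u v by auto
        then show False using b(3) configurationD(2)[OF assms(2)] by blast
      qed
    qed
  next
    fix d u
    assume "u \<in> InL ` fset X \<union> (\<lambda>e. Copy e X) ` y" "(d, u) \<in> order (es_seq S T)"
    then show "d \<in> InL ` fset X \<union> (\<lambda>e. Copy e X) ` y"
      using configurationD(3)[OF X] configurationD(3)[OF assms(2)]
      by (auto simp: es_seq_def seq_order_def)
  qed
qed

text \<open>Once a copy has been added, the left part already equals its maximal index, so no left
  event can follow and later copies carry the same index. If \<open>q\<close> is empty,
  \<open>X\<close> is arbitrary.\<close>

lemma securing_seqE:
  assumes "event_structure S" "securing (es_seq S T) es"
  obtains p q X where "es = map InL p @ map (\<lambda>e. Copy e X) q"
    "q \<noteq> [] \<Longrightarrow> max_configuration S (fset X) \<and> set p = fset X"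
    "securing S p" "securing T q"
proof -
  \<comment> \<open>The induction tracks only the shape of the list; that \<open>p\<close> and
    \<open>q\<close> are securings is recovered by projection afterwards.\<close>
  have "\<exists>p q X. es = map InL p @ map (\<lambda>e. Copy e X) q \<and>
    (q \<noteq> [] \<longrightarrow> max_configuration S (fset X) \<and> set p = fset X)"
    using assms(2)
  proof (induction rule: securing.induct)
    case (securing_snoc es e)
    then obtain p q X where es: "es = map InL p @ map (\<lambda>e. Copy e X) q"
      and q: "q \<noteq> [] \<longrightarrow> max_configuration S (fset X) \<and> set p = fset X"
      by blast
    note copy = configuration_seq_Copy[OF assms(1) securing_snoc.hyps(3)]
      and mx = configuration_seq_max[OF securing_snoc.hyps(3)]
    consider d where "e = InL d" | d Y where "e = Copy d Y"
      using securing_snoc.hyps(3) by (auto simp: configuration_def es_seq_def)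
    then show ?case
    proof cases
      case 1
      have "q = []"
      proof (rule ccontr)
        assume "q \<noteq> []"
        then obtain c where "c \<in> set q" by (cases q) auto
        \<comment> \<open>An earlier copy fixes the left part of the extended configuration to
          \<open>X\<close>, which \<open>p\<close> has exhausted, so \<open>d\<close> would be added
          twice.\<close>
        then have "d |\<in>| X" using copy[of c X] 1 es by auto
        then have "d \<in> set p" using q \<open>q \<noteq> []\<close> by simp
        then show False using securing_snoc.hyps(2) es 1 by auto
      qed
      then have "es @ [e] = map InL (p @ [d]) @ map (\<lambda>e. Copy e X) []"
        using es 1 by simp
      then show ?thesis by blast
    next
      case 2
      have p: "set p = fset Y" using copy[of d Y] 2 es by auto
      have "es @ [e] = map InL p @ map (\<lambda>e. Copy e Y) (q @ [d])"
      \<comment> \<open>The first copy chooses the index \<open>Y\<close>; any later one must agree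
        with \<open>X\<close>, since both index sets equal \<open>set p\<close>.\<close>
      proof (cases "q = []")
        case False
        then have "X = Y" using q p by (simp add: fset_inject)
        then show ?thesis using es 2 by simp
      qed (use es 2 in simp)
      then show ?thesis using p mx[of d Y] 2 by blast
    qed
  qed simp
  then obtain p q X where es: "es = map InL p @ map (\<lambda>e. Copy e X) q"
    and q: "q \<noteq> [] \<longrightarrow> max_configuration S (fset X) \<and> set p = fset X"
    by blast
  have "securing S (List.map_filter left_event es)"
    by (rule securing_map_filter[OF assms(2)])
      (use configuration_seq_left[OF assms(1)] in auto)
  then have "securing S p"
    by (simp add: es map_filter_append map_filter_map_Some map_filter_map_None)
  moreover have "securing T (List.map_filter (copied_event X) es)"
    by (rule securing_map_filter[OF assms(2)]) (use configuration_seq_right in auto)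
  then have "securing T q"
    by (simp add: es map_filter_append map_filter_map_Some map_filter_map_None)
  ultimately show thesis using that es q by blast
qed

text \<open>Without copies, extending the left part extends the whole. Once the left part is known
  to be maximal, copies over it can be added for any extension of \<open>set q\<close>.\<close>

lemma max_configuration_seq:
  assumes max: "max_configuration (es_seq S T) (InL ` set p \<union> (\<lambda>e. Copy e X) ` set q)"
    and q: "q \<noteq> [] \<Longrightarrow> max_configuration S (fset X) \<and> set p = fset X"
    and p: "configuration S (set p)" and q_conf: "configuration T (set q)"
  shows "max_configuration S (set p)" "max_configuration T (set q)"
proof -
  show maxp: "max_configuration S (set p)"
  proof (cases "q = []")
    case True
    have "y = set p" if "configuration S y" "set p \<subseteq> y" for y
    proof -
      have "InL ` y = InL ` set p \<union> (\<lambda>e. Copy e X) ` set q"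
        by (rule max_configurationD[OF max]) (use that True configuration_seq_InL in auto)
      then show ?thesis using True by auto
    qed
    then show ?thesis using p by (simp add: max_configuration_def)
  qed (use q in simp)
  \<comment> \<open>For empty \<open>q\<close> the given \<open>X\<close> need not be related to
    \<open>p\<close>, so the copies are indexed by the entries of \<open>p\<close> instead.\<close>
  obtain Y where Y: "fset Y = set p" "q \<noteq> [] \<Longrightarrow> Y = X"
  proof (cases "q = []")
    case True
    then show thesis using that[of "fset_of_list p"] by (simp add: fset_of_list.rep_eq)
  qed (use that[of X] q in simp)
  have "y = set q" if "configuration T y" "set q \<subseteq> y" for y
  proof -
    have eq: "InL ` fset Y \<union> (\<lambda>e. Copy e Y) ` y = InL ` set p \<union> (\<lambda>e. Copy e X) ` set q"
    proof (rule max_configurationD[OF max])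
      show "configuration (es_seq S T) (InL ` fset Y \<union> (\<lambda>e. Copy e Y) ` y)"
        using maxp Y(1) that(1) by (intro configuration_seqI) simp_all
      show "InL ` set p \<union> (\<lambda>e. Copy e X) ` set q \<subseteq> InL ` fset Y \<union> (\<lambda>e. Copy e Y) ` y"
        using Y that(2) by (cases "q = []") auto
    qed
    have "e \<in> set q" if "e \<in> y" for e
    proof -
      have "Copy e Y \<in> InL ` set p \<union> (\<lambda>e. Copy e X) ` set q"
        unfolding eq[symmetric] using that by simp
      then show ?thesis by auto
    qed
    then show ?thesis using that(2) by auto
  qed
  then show "max_configuration T (set q)"
    using q_conf by (simp add: max_configuration_def)
qed

subsection \<open>Running a securing\<close>

lemma map_event_label_simps [simp]:
  "event_label \<circ> InL = event_label" "event_label \<circ> InR = event_label"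
  "event_label \<circ> (\<lambda>e. Copy e X) = event_label"
  by auto

text \<open>The first step resolves the choice; an empty run would leave it unresolved, with a
  different final state.\<close>

lemma run_choice:
  assumes "run (Run C) w s" "w \<noteq> []"
  shows "run (Run (Choice C D)) w s" "run (Run (Choice D C)) w s"
  using assms by (cases w; auto intro: step_choice_l step_choice_r)+

lemma run_es_single:
  assumes "securing (es_single l) es" "C \<midarrow>l\<rightarrow> Tick"
  shows "\<exists>s. run (Run C) (map event_label es) s \<and>
    (max_configuration (es_single l) (set es) \<longrightarrow> s = Tick)"
  using securing_es_single[OF assms(1)]
proof
  assume "es = []"
  then show ?thesis using not_max_configuration_es_single by simp
next
  assume "es = [Base l]"
  then show ?thesis using assms(2) by (intro exI[of _ Tick]) simp
qed

lemma securing_run: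
  assumes "securing \<lbrakk>C\<rbrakk> es"
  shows "\<exists>s. run (Run C) (map event_label es) s \<and>
    (max_configuration \<lbrakk>C\<rbrakk> (set es) \<longrightarrow> s = Tick)"
  using assms
proof (induction C arbitrary: es)
  case Skip
  then show ?case using run_es_single[OF _ step_skip] by simp
next
  case (Atom a)
  then show ?case using run_es_single[OF _ step_atom] by simp
next
  case (Seq C1 C2)
  have sec: "securing (es_seq \<lbrakk>C1\<rbrakk> \<lbrakk>C2\<rbrakk>) es" using Seq.prems by simp
  obtain p q X where es: "es = map InL p @ map (\<lambda>e. Copy e X) q"
    and q: "q \<noteq> [] \<Longrightarrow> max_configuration \<lbrakk>C1\<rbrakk> (fset X) \<and> set p = fset X"
    and pq: "securing \<lbrakk>C1\<rbrakk> p" "securing \<lbrakk>C2\<rbrakk> q"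
    using securing_seqE[OF event_structure_interp sec] by metis
  obtain s where s: "run (Run C1) (map event_label p) s"
      "max_configuration \<lbrakk>C1\<rbrakk> (set p) \<longrightarrow> s = Tick"
    using Seq.IH(1)[OF pq(1)] by blast
  obtain t where t: "run (Run C2) (map event_label q) t"
      "max_configuration \<lbrakk>C2\<rbrakk> (set q) \<longrightarrow> t = Tick"
    using Seq.IH(2)[OF pq(2)] by blast
  have run1: "run (Run (Seq C1 C2)) (map event_label p) (seq_state C2 s)"
    using run_seq[OF s(1), of C2] by simp
  have word: "map event_label es = map event_label p @ map event_label q"
    by (simp add: es)
  \<comment> \<open>Here the first run ends in \<open>seq_state C2 Tick\<close>, which is
    \<open>Run C2\<close>, where the run over \<open>q\<close> starts.\<close>
  have run2: "run (Run (Seq C1 C2)) (map event_label es) t" if "s = Tick"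
    using run_append[OF run1] t(1) that by (simp add: word)
  have max: "s = Tick \<and> t = Tick" if "max_configuration \<lbrakk>Seq C1 C2\<rbrakk> (set es)"
    using max_configuration_seq[of "\<lbrakk>C1\<rbrakk>" "\<lbrakk>C2\<rbrakk>" p X q] that q s(2) t(2)
      securing_configuration[OF pq(1)] securing_configuration[OF pq(2)]
    by (auto simp: es)
  show ?case
  proof (cases "s = Tick")
    case True
    then show ?thesis using run2 max by blast
  next
    case False
    \<comment> \<open>A copy would make \<open>set p\<close> maximal and hence \<open>s\<close>
      equal to \<open>Tick\<close>. So the run of \<open>C1\<close> is all there is, and
      \<open>max\<close> shows that \<open>set es\<close> is not maximal.\<close>
    then have "q = []" using q s(2) by metis
    then show ?thesis using run1 max False by (auto simp: word)
  qed
next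
  case (Choice C1 C2)
  have sec: "securing (es_choice \<lbrakk>C1\<rbrakk> \<lbrakk>C2\<rbrakk>) es" using Choice.prems by simp
  from securing_configuration[OF sec] show ?case
  proof (cases rule: configuration_choiceE)
    case 1
    then obtain p where es: "es = map InL p" by (metis ex_map_conv image_iff subsetD)
    have "securing \<lbrakk>C1\<rbrakk> (List.map_filter left_event es)"
      by (rule securing_map_filter[OF sec]) (use configuration_choice_left in auto)
    then have "securing \<lbrakk>C1\<rbrakk> p" by (simp add: es map_filter_map_Some)
    then obtain s where s: "run (Run C1) (map event_label p) s"
        "max_configuration \<lbrakk>C1\<rbrakk> (set p) \<longrightarrow> s = Tick"
      using Choice.IH(1) by blast
    have "max_configuration \<lbrakk>C1\<rbrakk> (set p)" if "max_configuration \<lbrakk>Choice C1 C2\<rbrakk> (set es)"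
      using that by (auto simp: es intro: max_configuration_choice_InL)
    \<comment> \<open>For empty \<open>p\<close> the run stays at the choice; maximality is then
      impossible, as it would make the empty run of \<open>C1\<close> end in
      \<open>Tick\<close>.\<close>
    then show ?thesis using s run_choice(1)[OF s(1)] by (cases "p = []") (auto simp: es)
  next
    case 2
    then obtain p where es: "es = map InR p" by (metis ex_map_conv image_iff subsetD)
    have "securing \<lbrakk>C2\<rbrakk> (List.map_filter right_event es)"
      by (rule securing_map_filter[OF sec]) (use configuration_choice_right in auto)
    then have "securing \<lbrakk>C2\<rbrakk> p" by (simp add: es map_filter_map_Some)
    then obtain s where s: "run (Run C2) (map event_label p) s"
        "max_configuration \<lbrakk>C2\<rbrakk> (set p) \<longrightarrow> s = Tick"
      using Choice.IH(2) by blast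
    have "max_configuration \<lbrakk>C2\<rbrakk> (set p)" if "max_configuration \<lbrakk>Choice C1 C2\<rbrakk> (set es)"
      using that by (auto simp: es intro: max_configuration_choice_InR)
    then show ?thesis using s run_choice(2)[OF s(1)] by (cases "p = []") (auto simp: es)
  qed
next
  case (Par C1 C2)
  have sec: "securing (es_par \<lbrakk>C1\<rbrakk> \<lbrakk>C2\<rbrakk>) es" using Par.prems by simp
  let ?p = "List.map_filter left_event es" and ?q = "List.map_filter right_event es"
  have sets: "set ?p = {d. InL d \<in> set es}" "set ?q = {d. InR d \<in> set es}"
    by (simp_all add: set_map_filter_eq)
  have "securing \<lbrakk>C1\<rbrakk> ?p"
    by (rule securing_map_filter[OF sec]) (use configuration_par_left in auto)
  then obtain s where s: "run (Run C1) (map event_label ?p) s"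
      "max_configuration \<lbrakk>C1\<rbrakk> (set ?p) \<longrightarrow> s = Tick"
    using Par.IH(1) by blast
  have "securing \<lbrakk>C2\<rbrakk> ?q"
    by (rule securing_map_filter[OF sec]) (use configuration_par_right in auto)
  then obtain t where t: "run (Run C2) (map event_label ?q) t"
      "max_configuration \<lbrakk>C2\<rbrakk> (set ?q) \<longrightarrow> t = Tick"
    using Par.IH(2) by blast
  have "set es \<subseteq> range InL \<union> range InR"
    using securing_configuration[OF sec] by (auto simp: configuration_def es_par_def)
  then have "run (Run (Par C1 C2)) (map event_label es) (par_state s t)"
    using run_par[OF _ s(1) t(1)] by simp
  \<comment> \<open>Maximality passes to both projections, so both components reach
    \<open>Tick\<close>.\<close>
  moreover have "par_state s t = Tick" if "max_configuration \<lbrakk>Par C1 C2\<rbrakk> (set es)"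
    using max_configuration_par[of "\<lbrakk>C1\<rbrakk>" "\<lbrakk>C2\<rbrakk>" "set es"] that s(2) t(2) by (simp add: sets)
  ultimately show ?case by blast
qed

theorem mainTheorem2:
  fixes C :: "'a com" and x :: "'a event set" and xs :: "'a event set list"
    and es :: "'a event list" and \<omega> :: "'a label list"
  assumes "configuration \<lbrakk>C\<rbrakk> x"
    and "finite x"
    and "x \<noteq> {}"
    and "covering_chain \<lbrakk>C\<rbrakk> x xs es"
    and "\<omega> = map event_label es"
  shows "\<exists>C'. C \<midarrow>\<omega>\<twoheadrightarrow> C'"
proof -
  obtain s where "run (Run C) \<omega> s"
    using securing_run[OF covering_chain_imp_securing[OF assms(4)]] assms(5) by blast
  \<comment> \<open>The chain starts at the empty set and ends at the non-empty \<open>x\<close>, so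
    at least one event is added and the word is non-empty.\<close>
  moreover have "es \<noteq> []"
    using assms(3,4) by (cases xs) (auto simp: covering_chain_def)
  ultimately show ?thesis using run_imp_word_step assms(5) by blast
qed

end
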